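(* Let $q$ be a power of an odd prime, let $n\ge 2$, and let $\mathcal{S}\subseteq\mathbb{F}_q^n$ be a conical Kakeya set or a conical Nikodym set. Then $$|\mathcal{S}|\ge\left(\frac{q-1}{2n}\right)^n.$$
   Context: Fix a non-square $g\in\mathbb{F}_q^*$. For vectors $\underline{a},\underline{b},\underline{c}\in\mathbb{F}_q^n$ with $\underline{b},\underline{c}$ linearly independent, define: (H) a hyperbola $\mathcal{H}=\{\underline{a}+t\underline{b}+t^{-1}\underline{c}: t\in\mathbb{F}_q^*\}$; (P) a parabola $\mathcal{P}=\{\underline{a}+t\underline{b}+t^{2}\underline{c}: t\in\mathbb{F}_q\}$; (E) an ellipse $\mathcal{E}=\{\underline{a}+x\underline{b}+y\underline{c}: (x,y)\in\mathbb{F}_q^2,\ y^2=gx^2+k\}$ for some $k\in\mathbb{F}_q^*$. A set $\mathcal{N}\subseteq\mathbb{F}_q^n$ is a conical Nikodym set if for every $\underline{x}\in\mathbb{F}_q^n$ there is a set $\mathcal{C}$ of one of the forms (H), (P), (E) with $\underline{x}\in\mathcal{C}$ and $\mathcal{C}\setminus\{\underline{x}\}\subseteq\mathcal{N}$. A set $\mathcal{K}\subseteq\mathbb{F}_q^n$ is a conical Kakeya set if for every $\underline{d}\in\mathbb{F}_q^n\setminus\{\underline{0}\}$ there exist $\underline{a},\underline{b},\underline{c}\in\mathbb{F}_q^n$ with $\underline{b},\underline{c}$ linearly independent such that either the hyperbola (H) with $\underline{d}\in\{\underline{b},\underline{c}\}$ is contained in $\mathcal{K}$, or the parabola (P) with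 $\underline{d}=\underline{c}$ is contained in $\mathcal{K}$. *)

theory Defs
  imports "HOL-Analysis.Cartesian_Space" "HOL-Computational_Algebra.Primes"
begin

definition lin_indep2 :: "'a::field ^ 'n \<Rightarrow> 'a ^ 'n \<Rightarrow> bool" where
  "lin_indep2 b c \<longleftrightarrow> b \<noteq> c \<and> vec.independent {b, c}"
  (* As {b, b} = {b}, the condition b \<noteq> c is needed to speak about the family (b, c). *)

definition hyperbola :: "'a::field ^ 'n \<Rightarrow> 'a ^ 'n \<Rightarrow> 'a ^ 'n \<Rightarrow> ('a ^ 'n) set" where
  "hyperbola a b c = {a + t *s b + inverse t *s c |t. t \<noteq> 0}"

definition parabola :: "'a::field ^ 'n \<Rightarrow> 'a ^ 'n \<Rightarrow> 'a ^ 'n \<Rightarrow> ('a ^ 'n) set" where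
  "parabola a b c = {a + t *s b + t\<^sup>2 *s c |t. True}"

definition ellipse ::
  "'a::field \<Rightarrow> 'a \<Rightarrow> 'a ^ 'n \<Rightarrow> 'a ^ 'n \<Rightarrow> 'a ^ 'n \<Rightarrow> ('a ^ 'n) set" where
  "ellipse g k a b c = {a + x *s b + y *s c |x y. y\<^sup>2 = g * x\<^sup>2 + k}"

definition is_conic :: "'a::field \<Rightarrow> ('a ^ 'n) set \<Rightarrow> bool" where
  "is_conic g C \<longleftrightarrow>
    (\<exists>a b c. lin_indep2 b c \<and>
      (C = hyperbola a b c \<or> C = parabola a b c \<or> (\<exists>k. k \<noteq> 0 \<and> C = ellipse g k a b c)))"

definition conical_Nikodym :: "'a::field \<Rightarrow> ('a ^ 'n) set \<Rightarrow> bool" where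
  "conical_Nikodym g N \<longleftrightarrow> (\<forall>x. \<exists>C. is_conic g C \<and> x \<in> C \<and> C - {x} \<subseteq> N)"

definition conical_Kakeya :: "('a::field ^ 'n) set \<Rightarrow> bool" where
  "conical_Kakeya K \<longleftrightarrow>
    (\<forall>d. d \<noteq> 0 \<longrightarrow>
      (\<exists>a b c. lin_indep2 b c \<and>
        (d \<in> {b, c} \<and> hyperbola a b c \<subseteq> K \<or> d = c \<and> parabola a b c \<subseteq> K)))"

end

(*
The polynomial method. Let e = floor((q - 3) / (2n)). The polynomials of degree at most e in each
variable form a space of dimension (e + 1)^n >= ((q - 1) / 2n)^n, so if S is smaller than that, a
nonzero polynomial P in this space vanishes on S; its total degree d satisfies 2d <= q - 3. Along a
conic, P becomes a polynomial of degree at most 2d in a rational parameter, so it vanishes on the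
whole conic as soon as it vanishes at more than 2d parameters. For a Nikodym set this makes P vanish
everywhere; for a Kakeya set the points at infinity make the leading form of P vanish everywhere.
Since e < q, both are impossible.
*)

theory Submission
  imports Defs "HOL-Computational_Algebra.Polynomial"
begin

section \<open>Polynomials of bounded degree in each variable\<close>

text \<open>A polynomial is given by its coefficients \<open>f\<close> on the finite set of exponent
  vectors bounded by \<open>e\<close>; values of \<open>f\<close> elsewhere do not matter.\<close>

definition mpeval :: "'i set \<Rightarrow> nat \<Rightarrow> (('i \<Rightarrow> nat) \<Rightarrow> 'a) \<Rightarrow> ('i \<Rightarrow> 'a) \<Rightarrow> 'a::comm_semiring_1"
  where "mpeval I e f x = (\<Sum>\<alpha>\<in>I \<rightarrow>\<^sub>E {..e}. f \<alpha> * (\<Prod>i\<in>I. x i ^ \<alpha> i))"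

lemma mpeval_insert:
  assumes "finite I" "j \<notin> I"
  shows "mpeval (insert j I) e f x = (\<Sum>k\<le>e. mpeval I e (\<lambda>\<alpha>. f (\<alpha>(j := k))) x * x j ^ k)"
proof -
  have "mpeval (insert j I) e f x =
      (\<Sum>(k, \<alpha>)\<in>{..e} \<times> (I \<rightarrow>\<^sub>E {..e}).
         f (\<alpha>(j := k)) * (\<Prod>i\<in>insert j I. x i ^ (\<alpha>(j := k)) i))"
    unfolding mpeval_def PiE_insert_eq
    by (subst sum.reindex[OF inj_combinator[OF assms(2)]]) (simp add: case_prod_unfold)
  also have "\<dots> = (\<Sum>(k, \<alpha>)\<in>{..e} \<times> (I \<rightarrow>\<^sub>E {..e}).
         (f (\<alpha>(j := k)) * (\<Prod>i\<in>I. x i ^ \<alpha> i)) * x j ^ k)"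
  proof (intro sum.cong refl, clarify)
    fix k \<alpha>
    have "(\<Prod>i\<in>I. x i ^ (\<alpha>(j := k)) i) = (\<Prod>i\<in>I. x i ^ \<alpha> i)"
      using assms(2) by (intro prod.cong) auto
    then show "f (\<alpha>(j := k)) * (\<Prod>i\<in>insert j I. x i ^ (\<alpha>(j := k)) i) =
        f (\<alpha>(j := k)) * (\<Prod>i\<in>I. x i ^ \<alpha> i) * x j ^ k"
      using assms by (simp add: mult_ac)
  qed
  also have "\<dots> = (\<Sum>k\<le>e. mpeval I e (\<lambda>\<alpha>. f (\<alpha>(j := k))) x * x j ^ k)"
    by (simp add: mpeval_def sum.cartesian_product[symmetric] sum_distrib_right)
  finally show ?thesis .
qed

lemma poly_eq_0_if_many_roots:
  fixes p :: "'a::idom poly"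
  assumes "degree p < card T" "\<And>t. t \<in> T \<Longrightarrow> poly p t = 0"
  shows "p = 0"
proof (rule ccontr)
  assume "p \<noteq> 0"
  then have "finite {t. poly p t = 0}" "card {t. poly p t = 0} \<le> degree p"
    by (simp_all add: poly_roots_finite card_poly_roots_bound)
  moreover have "T \<subseteq> {t. poly p t = 0}" using assms(2) by auto
  ultimately show False using assms(1) card_mono[of "{t. poly p t = 0}" T] by linarith
qed

text \<open>With the other variables fixed, a polynomial in \<open>x j\<close> of degree at most
  \<open>e\<close> vanishes on the whole field, so its coefficients are zero. They are polynomials
  in the remaining variables, to which the induction hypothesis applies.\<close>

lemma coeff_eq_0_if_mpeval_eq_0:
  fixes f :: "('i \<Rightarrow> nat) \<Rightarrow> 'a::{field,finite}"
  assumes "finite I" "e < CARD('a)" "\<And>x. mpeval I e f x = 0" "\<alpha> \<in> I \<rightarrow>\<^sub>E {..e}"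
  shows "f \<alpha> = 0"
  using assms(1,3,4)
proof (induction I arbitrary: f \<alpha> rule: finite_induct)
  case empty
  then show ?case by (simp add: mpeval_def)
next
  case (insert j I)
  have eq0: "mpeval I e (\<lambda>\<alpha>. f (\<alpha>(j := k))) x = 0" if "k \<le> e" for k x
  proof -
    define r where "r = (\<Sum>k\<le>e. monom (mpeval I e (\<lambda>\<alpha>. f (\<alpha>(j := k))) x) k)"
    have "degree r \<le> e"
      unfolding r_def
    proof (rule degree_sum_le)
      show "degree (monom (mpeval I e (\<lambda>\<alpha>. f (\<alpha>(j := k))) x) k) \<le> e" if "k \<in> {..e}" for k
        using that order_trans[OF degree_monom_le, of k e] by simp
    qed simp
    moreover have "poly r t = 0" for t
    proof -
      have "mpeval I e h (x(j := t)) = mpeval I e h x" for h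
        unfolding mpeval_def using insert.hyps
        by (intro sum.cong arg_cong2[of _ _ _ _ "(*)"] prod.cong) auto
      then show ?thesis
        using insert.prems(1)[of "x(j := t)"] insert.hyps
        by (simp add: r_def poly_sum poly_monom mpeval_insert del: fun_upd_apply) simp
    qed
    ultimately have "r = 0"
      using assms(2) by (intro poly_eq_0_if_many_roots[of r UNIV]) auto
    then have "coeff r k = 0" by simp
    then show ?thesis using that by (simp add: r_def coeff_sum)
  qed
  obtain k \<beta> where "\<alpha> = \<beta>(j := k)" "k \<le> e" "\<beta> \<in> I \<rightarrow>\<^sub>E {..e}"
    using insert.prems(2) by (auto simp: PiE_insert_eq)
  then show ?case using insert.IH[OF eq0] by simp
qed

lemma coeff_eq_0_if_mpeval_vec_eq_0:
  fixes f :: "('n::finite \<Rightarrow> nat) \<Rightarrow> 'a::{field,finite}"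
  assumes "CARD('n) * e < CARD('a)" "\<And>v :: 'a ^ 'n. mpeval UNIV e f (($) v) = 0"
    and "\<alpha> \<in> UNIV \<rightarrow>\<^sub>E {..e}"
  shows "f \<alpha> = 0"
proof (rule coeff_eq_0_if_mpeval_eq_0[of UNIV e f])
  have "1 * e \<le> CARD('n) * e" by (intro mult_le_mono1) (simp add: Suc_leI)
  then show "e < CARD('a)" using assms(1) by linarith
  show "mpeval UNIV e f x = 0" for x
    using assms(2)[of "vec_lambda x"] by (simp add: vec_lambda_inverse)
qed (use assms(3) in auto)

section \<open>A nonzero polynomial vanishing on a small set\<close>

text \<open>Pigeonhole takes the place of linear algebra: there are more coefficient families than
  functions on \<open>S\<close>, so two different polynomials agree on \<open>S\<close>, and their
  difference is taken.\<close>

lemma exists_vanishing_mpeval: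
  fixes S :: "('i \<Rightarrow> 'a::{field,finite}) set"
  assumes "finite I" "finite S" "card S < (e + 1) ^ card I"
  obtains f where "\<And>x. x \<in> S \<Longrightarrow> mpeval I e f x = 0" "\<exists>\<alpha>\<in>I \<rightarrow>\<^sub>E {..e}. f \<alpha> \<noteq> 0"
proof -
  define A where "A = I \<rightarrow>\<^sub>E {..e}"
  define X where "X = A \<rightarrow>\<^sub>E (UNIV :: 'a set)"
  define Y where "Y = S \<rightarrow>\<^sub>E (UNIV :: 'a set)"
  define ev where "ev f = restrict (mpeval I e f) S" for f :: "('i \<Rightarrow> nat) \<Rightarrow> 'a"
  have A: "finite A" "card A = (e + 1) ^ card I"
    using assms(1) by (auto simp: A_def card_PiE intro: finite_PiE)
  have "1 < CARD('a)"
    using card_mono[of UNIV "{0, 1 :: 'a}"] by simp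
  then have "card Y < card X"
    using A assms by (simp add: X_def Y_def card_PiE)
  moreover have "ev ` X \<subseteq> Y" "finite Y"
    using assms by (auto simp: ev_def X_def Y_def intro: finite_PiE)
  ultimately have "\<not> inj_on ev X"
    using card_inj_on_le leD by blast
  then obtain f h where fh: "f \<in> X" "h \<in> X" "ev f = ev h" "f \<noteq> h"
    by (auto simp: inj_on_def)
  show thesis
  proof
    fix x assume "x \<in> S"
    then have "mpeval I e f x = mpeval I e h x"
      using fun_cong[OF fh(3), of x] by (simp add: ev_def)
    then show "mpeval I e (\<lambda>\<alpha>. f \<alpha> - h \<alpha>) x = 0"
      by (simp add: mpeval_def left_diff_distrib sum_subtractf)
  next
    \<comment> \<open>Members of \<open>X\<close> are extensional, so two different ones differ at a
      point of \<open>A\<close>.\<close>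
    show "\<exists>\<alpha>\<in>I \<rightarrow>\<^sub>E {..e}. f \<alpha> - h \<alpha> \<noteq> 0"
      using fh PiE_ext[of f A _ h] unfolding X_def A_def by (metis right_minus_eq)
  qed
qed

section \<open>Pullback to rational curves of degree two\<close>

text \<open>In every other term of the convolution one index exceeds its bound. Upper bounds replace
  exact degrees because the coefficients at 2 of \<open>N i\<close> and \<open>D\<close> may vanish
  below.\<close>

lemma coeff_mult_degree_bound:
  fixes p r :: "'a::comm_semiring_0 poly"
  assumes "degree p \<le> m" "degree r \<le> k"
  shows "coeff (p * r) (m + k) = coeff p m * coeff r k"
proof -
  have "coeff p i * coeff r (m + k - i) = 0" if "i \<le> m + k" "i \<noteq> m" for i
  proof (cases "i < m")
    case True
    then show ?thesis using assms by (simp add: coeff_eq_0)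
  next
    case False
    then show ?thesis using assms that by (simp add: coeff_eq_0)
  qed
  then have "coeff (p * r) (m + k) = (\<Sum>i\<le>m + k. if i = m then coeff p m * coeff r k else 0)"
    unfolding coeff_mult by (intro sum.cong) auto
  then show ?thesis by simp
qed

lemma degree_power_bound:
  fixes p :: "'a::comm_semiring_1 poly"
  assumes "degree p \<le> m"
  shows "degree (p ^ k) \<le> m * k"
  using degree_power_le[of p k] assms by (meson mult_le_mono1 order_trans)

lemma coeff_power_degree_bound:
  fixes p :: "'a::comm_semiring_1 poly"
  assumes "degree p \<le> m"
  shows "coeff (p ^ k) (m * k) = coeff p m ^ k"
  by (induction k) (simp_all add: assms coeff_mult_degree_bound degree_power_bound)

lemma prod_degree_bound:
  fixes p :: "'i \<Rightarrow> 'a::comm_semiring_1 poly"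
  assumes "finite I" "\<And>i. i \<in> I \<Longrightarrow> degree (p i) \<le> m i"
  shows "degree (prod p I) \<le> sum m I \<and> coeff (prod p I) (sum m I) = (\<Prod>i\<in>I. coeff (p i) (m i))"
  using assms
proof (induction I rule: finite_induct)
  case (insert j I)
  then have "degree (p j * prod p I) \<le> m j + sum m I"
    by (intro order_trans[OF degree_mult_le] add_mono) auto
  then show ?case using insert by (simp add: coeff_mult_degree_bound)
qed simp

text \<open>\<open>mpeval I e f\<close> of total degree at most \<open>d\<close> is pulled back along the rational curve \<open>N / D\<close> of
  degree two and multiplied by \<open>D ^ d\<close>. The first conclusion concerns the finite parameters, the
  second one, with \<open>0 ^ 0 = 1\<close>, the parameter at infinity: it is the value at the point
  \<open>N(\<infinity>) / D(\<infinity>)\<close>, or the value of the form of degree \<open>d\<close> at \<open>N(\<infinity>)\<close> if \<open>D(\<infinity>) = 0\<close>.\<close>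

lemma mpeval_vanishes_on_conic:
  fixes N :: "'i \<Rightarrow> 'a::{field,finite} poly" and D :: "'a poly"
  assumes I: "finite I" and N: "\<And>i. degree (N i) \<le> 2" and D: "degree D \<le> 2"
    and supp: "\<And>\<alpha>. \<alpha> \<in> I \<rightarrow>\<^sub>E {..e} \<Longrightarrow> f \<alpha> \<noteq> 0 \<Longrightarrow> sum \<alpha> I \<le> d"
    and T: "2 * d < card T"
    and vanish: "\<And>t. t \<in> T \<Longrightarrow> poly D t \<noteq> 0 \<and> mpeval I e f (\<lambda>i. poly (N i) t / poly D t) = 0"
  shows "poly D t \<noteq> 0 \<Longrightarrow> mpeval I e f (\<lambda>i. poly (N i) t / poly D t) = 0"
    and "mpeval I e (\<lambda>\<alpha>. f \<alpha> * coeff D 2 ^ (d - sum \<alpha> I)) (\<lambda>i. coeff (N i) 2) = 0"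
proof -
  define h where "h \<alpha> = D ^ (d - sum \<alpha> I) * (\<Prod>i\<in>I. N i ^ \<alpha> i)" for \<alpha>
  define H where "H = (\<Sum>\<alpha>\<in>I \<rightarrow>\<^sub>E {..e}. smult (f \<alpha>) (h \<alpha>))"
  have h: "degree (h \<alpha>) \<le> 2 * d \<and>
      coeff (h \<alpha>) (2 * d) = coeff D 2 ^ (d - sum \<alpha> I) * (\<Prod>i\<in>I. coeff (N i) 2 ^ \<alpha> i)"
    if "sum \<alpha> I \<le> d" for \<alpha>
  proof -
    have P: "degree (\<Prod>i\<in>I. N i ^ \<alpha> i) \<le> 2 * sum \<alpha> I"
      "coeff (\<Prod>i\<in>I. N i ^ \<alpha> i) (2 * sum \<alpha> I) = (\<Prod>i\<in>I. coeff (N i) 2 ^ \<alpha> i)"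
      using prod_degree_bound[OF I, of "\<lambda>i. N i ^ \<alpha> i" "\<lambda>i. 2 * \<alpha> i"] N
      by (auto simp: degree_power_bound coeff_power_degree_bound sum_distrib_left)
    have eq: "2 * d = 2 * (d - sum \<alpha> I) + 2 * sum \<alpha> I" using that by simp
    show ?thesis
      unfolding h_def eq using P D
      by (auto simp: coeff_mult_degree_bound degree_power_bound coeff_power_degree_bound
          simp del: add_mult_distrib2
          intro!: order_trans[OF degree_mult_le] add_mono)
  qed
  have at: "poly H t = poly D t ^ d * mpeval I e f (\<lambda>i. poly (N i) t / poly D t)"
    if "poly D t \<noteq> 0" for t
    unfolding H_def mpeval_def poly_sum sum_distrib_left
  proof (rule sum.cong[OF refl])
    fix \<alpha> assume \<alpha>: "\<alpha> \<in> I \<rightarrow>\<^sub>E {..e}"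
    show "poly (smult (f \<alpha>) (h \<alpha>)) t =
        poly D t ^ d * (f \<alpha> * (\<Prod>i\<in>I. (poly (N i) t / poly D t) ^ \<alpha> i))"
    proof (cases "f \<alpha> = 0")
      case False
      then have "poly D t ^ d = poly D t ^ (d - sum \<alpha> I) * poly D t ^ sum \<alpha> I"
        using supp[OF \<alpha>] by (simp flip: power_add)
      moreover have "(\<Prod>i\<in>I. (poly (N i) t / poly D t) ^ \<alpha> i) =
          (\<Prod>i\<in>I. poly (N i) t ^ \<alpha> i) / poly D t ^ sum \<alpha> I"
        by (simp add: power_divide prod_dividef power_sum)
      ultimately show ?thesis
        using that by (simp add: h_def poly_prod)
    qed simp
  qed
  have "degree H \<le> 2 * d"
    unfolding H_def
  proof (rule degree_sum_le)
    fix \<alpha> assume "\<alpha> \<in> I \<rightarrow>\<^sub>E {..e}"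
    then show "degree (smult (f \<alpha>) (h \<alpha>)) \<le> 2 * d"
      using supp h by (cases "f \<alpha> = 0") auto
  qed (use I in \<open>auto intro: finite_PiE\<close>)
  then have "H = 0"
    using T vanish at by (intro poly_eq_0_if_many_roots[of H T]) auto
  then show "poly D t \<noteq> 0 \<Longrightarrow> mpeval I e f (\<lambda>i. poly (N i) t / poly D t) = 0"
    using at by auto
  have "mpeval I e (\<lambda>\<alpha>. f \<alpha> * coeff D 2 ^ (d - sum \<alpha> I)) (\<lambda>i. coeff (N i) 2) = coeff H (2 * d)"
    unfolding H_def mpeval_def coeff_sum
  proof (rule sum.cong[OF refl])
    fix \<alpha> assume "\<alpha> \<in> I \<rightarrow>\<^sub>E {..e}"
    then show "f \<alpha> * coeff D 2 ^ (d - sum \<alpha> I) * (\<Prod>i\<in>I. coeff (N i) 2 ^ \<alpha> i) =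
        coeff (smult (f \<alpha>) (h \<alpha>)) (2 * d)"
      using supp h by (cases "f \<alpha> = 0") (auto simp: mult_ac)
  qed
  with \<open>H = 0\<close> show "mpeval I e (\<lambda>\<alpha>. f \<alpha> * coeff D 2 ^ (d - sum \<alpha> I)) (\<lambda>i. coeff (N i) 2) = 0"
    by simp
qed

section \<open>Conics and the recovery of a missing point\<close>

lemma lin_indep2_eq_0:
  assumes "lin_indep2 b c" "s *s b + t *s c = 0"
  shows "s = 0 \<and> t = 0"
proof -
  have ind: "\<And>u. (\<Sum>v\<in>{b, c}. u v *s v) = 0 \<Longrightarrow> \<forall>v\<in>{b, c}. u v = 0"
    using assms(1) vec.independentD[of "{b, c}" "{b, c}"] by (auto simp: lin_indep2_def)
  have "b \<noteq> c" using assms(1) by (simp add: lin_indep2_def)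
  then show ?thesis
    using ind[of "\<lambda>v. if v = b then s else t"] assms(2) by auto
qed

lemma lin_indep2_eqD:
  assumes "lin_indep2 b c" "a + s *s b + t *s c = a + s' *s b + t' *s c"
  shows "s = s'" "t = t'"
proof -
  have "(s - s') *s b + (t - t') *s c = 0"
    using assms(2) by (simp add: vec_eq_iff algebra_simps)
  from lin_indep2_eq_0[OF assms(1) this] show "s = s'" "t = t'" by auto
qed

lemma hyperbola_commute: "hyperbola a b c = hyperbola a c b"
proof -
  have "hyperbola a b c \<subseteq> hyperbola a c b" for a b c :: "'a::field ^ 'n"
  proof
    fix x assume "x \<in> hyperbola a b c"
    then obtain t where "t \<noteq> 0" "x = a + t *s b + inverse t *s c"
      by (auto simp: hyperbola_def)
    then have "inverse t \<noteq> 0" "x = a + inverse t *s c + inverse (inverse t) *s b"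
      by (auto simp: algebra_simps)
    then show "x \<in> hyperbola a c b" unfolding hyperbola_def by blast
  qed
  then show ?thesis by blast
qed


lemma sum_le_of_PiE_atMost:
  assumes "\<alpha> \<in> I \<rightarrow>\<^sub>E {..e::nat}"
  shows "sum \<alpha> I \<le> card I * e"
  using sum_bounded_above[of I \<alpha> e] assms by (auto simp: PiE_iff)

lemma mpeval_vanishes_on_ellipse:
  fixes a b c :: "'a::{field,finite} ^ 'n"
  assumes g: "\<not> (\<exists>h. g = h\<^sup>2)" and k: "k \<noteq> 0" and bc: "lin_indep2 b c"
    and x: "x \<in> ellipse g k a b c"
    and deg: "2 * (CARD('n) * e) < CARD('a)"
    and zero: "\<And>y. y \<in> ellipse g k a b c - {x} \<Longrightarrow> mpeval UNIV e f (($) y) = 0"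
  shows "mpeval UNIV e f (($) x) = 0"
proof -
  \<comment> \<open>In characteristic two every element of a finite field is a square.\<close>
  have two: "(2 :: 'a) \<noteq> 0"
  proof
    assume two: "(2 :: 'a) = 0"
    have "inj (\<lambda>h :: 'a. h\<^sup>2)"
    proof (rule injI)
      fix h k :: 'a assume "h\<^sup>2 = k\<^sup>2"
      moreover have "(h - k)\<^sup>2 = h\<^sup>2 - k\<^sup>2 + 2 * (k * (k - h))"
        by (simp add: power2_eq_square algebra_simps)
      ultimately have "(h - k)\<^sup>2 = 0" using two by simp
      then show "h = k" by simp
    qed
    then have "surj (\<lambda>h :: 'a. h\<^sup>2)" by (simp add: finite_UNIV_inj_surj)
    then show False using g by (metis surjD)
  qed
  have g0: "g \<noteq> 0" using g by (metis zero_power2)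
  obtain u v where uv: "x = a + u *s b + v *s c" "v\<^sup>2 = g * u\<^sup>2 + k"
    using x by (auto simp: ellipse_def)
  \<comment> \<open>Project the ellipse from the point with coordinates \<open>(u, - v)\<close>: the line of slope \<open>t\<close> meets it again in
    \<open>N(t) / D(t)\<close>, and the point \<open>x\<close>, with coordinates \<open>(u, v)\<close>, has the parameter infinity.\<close>
  define D where "D = [:- g, 0, 1:]"
  define N where "N i = [:g * (u * b $ i + v * c $ i - a $ i),
      2 * (v * b $ i + g * u * c $ i), x $ i:]" for i
  have D: "poly D t = t\<^sup>2 - g" "poly D t \<noteq> 0" for t
    using g by (auto simp: D_def power2_eq_square)
  have "mpeval UNIV e (\<lambda>\<alpha>. f \<alpha> * coeff D 2 ^ (CARD('n) * e - sum \<alpha> UNIV)) (\<lambda>i. coeff (N i) 2) = 0"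
  proof (rule mpeval_vanishes_on_conic(2)[where T = UNIV])
    fix t
    \<comment> \<open>The second intersection is \<open>(u + s, t * s - v)\<close> with
      \<open>s = 2 * (g * u + t * v) / (t\<^sup>2 - g)\<close>.\<close>
    define X where "X = (g * u + 2 * v * t + u * t\<^sup>2) / poly D t"
    define Y where "Y = (g * v + 2 * g * u * t + v * t\<^sup>2) / poly D t"
    define y where "y = a + X *s b + Y *s c"
    have XY: "X * (t\<^sup>2 - g) = g * u + 2 * v * t + u * t\<^sup>2"
      "Y * (t\<^sup>2 - g) = g * v + 2 * g * u * t + v * t\<^sup>2" and tg: "t\<^sup>2 - g \<noteq> 0"
      using D[of t] by (auto simp: X_def Y_def)
    \<comment> \<open>This is multiplicativity of the norm from the quadratic extension by a root r
      of \<open>g\<close>: \<open>Y + X * r\<close> is \<open>v + u * r\<close> times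
      \<open>(t + r) / (t - r)\<close>, which has norm one.\<close>
    have "(Y\<^sup>2 - g * X\<^sup>2) * (t\<^sup>2 - g)\<^sup>2 = (Y * (t\<^sup>2 - g))\<^sup>2 - g * (X * (t\<^sup>2 - g))\<^sup>2"
      by algebra
    also have "\<dots> = (v\<^sup>2 - g * u\<^sup>2) * (t\<^sup>2 - g)\<^sup>2"
      unfolding XY by algebra
    finally have "Y\<^sup>2 = g * X\<^sup>2 + k"
      using tg unfolding uv(2) by (simp add: diff_eq_eq add.commute)
    then have "y \<in> ellipse g k a b c" by (auto simp: y_def ellipse_def)
    moreover have "y \<noteq> x"
    proof
      assume "y = x"
      then have eq: "X = u" "Y = v"
        using lin_indep2_eqD[OF bc] unfolding y_def uv(1) by blast+
      \<comment> \<open>Cancelling \<open>2\<close> and \<open>g\<close> leaves a homogeneous linear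
        system in \<open>u\<close> and \<open>v\<close> of determinant \<open>g - t\<^sup>2\<close>,
        so both vanish, against \<open>k \<noteq> 0\<close>.\<close>
      have "2 * (g * u + v * t) = 0" "(2 * g) * (v + u * t) = 0"
        using XY unfolding eq by algebra+
      then have 1: "g * u + v * t = 0" "v + u * t = 0" using two g0 by (simp_all only: mult_eq_0_iff) auto
      then have "u * (t\<^sup>2 - g) = 0" by algebra
      then have "u = 0" using tg by simp
      with 1 uv(2) k show False by simp
    qed
    moreover have "($) y = (\<lambda>i. poly (N i) t / poly D t)"
    proof
      fix i
      have "poly (N i) t = a $ i * poly D t + (X * (t\<^sup>2 - g)) * b $ i + (Y * (t\<^sup>2 - g)) * c $ i"
        unfolding XY by (simp add: N_def D uv(1) power2_eq_square algebra_simps)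
      then show "y $ i = poly (N i) t / poly D t"
        using D(2)[of t] unfolding D(1)[symmetric] by (simp add: y_def field_simps)
    qed
    ultimately show "poly D t \<noteq> 0 \<and> mpeval UNIV e f (\<lambda>i. poly (N i) t / poly D t) = 0"
      using D zero[of y] by simp
  qed (use deg sum_le_of_PiE_atMost in \<open>auto simp: N_def D_def\<close>)
  then show ?thesis by (simp add: N_def D_def numeral_2_eq_2)
qed

text \<open>Only the parameter of \<open>x\<close> is lost, which leaves \<open>CARD('a) - 1\<close>
  zeros of the pullback.\<close>

lemma mpeval_vanishes_on_parabola:
  fixes a b c :: "'a::{field,finite} ^ 'n"
  assumes bc: "lin_indep2 b c" and x: "x \<in> parabola a b c"
    and deg: "2 * (CARD('n) * e) + 1 < CARD('a)"
    and zero: "\<And>y. y \<in> parabola a b c - {x} \<Longrightarrow> mpeval UNIV e f (($) y) = 0"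
  shows "mpeval UNIV e f (($) x) = 0"
proof -
  define N where "N i = [:a $ i, b $ i, c $ i:]" for i
  define P where "P t = a + t *s b + t\<^sup>2 *s c" for t
  have P: "($) (P t) = (\<lambda>i. poly (N i) t / poly 1 t)" for t
    by (rule ext) (simp add: P_def N_def power2_eq_square algebra_simps)
  obtain u where u: "x = P u" using x by (auto simp: parabola_def P_def)
  have "mpeval UNIV e f (\<lambda>i. poly (N i) u / poly 1 u) = 0"
  proof (rule mpeval_vanishes_on_conic(1)[where T = "- {u}"])
    fix t assume "t \<in> - {u}"
    then have "P t \<noteq> P u" using lin_indep2_eqD(1)[OF bc] by (auto simp: P_def)
    then have "P t \<in> parabola a b c - {x}" by (auto simp: u parabola_def P_def)
    then show "poly 1 t \<noteq> 0 \<and> mpeval UNIV e f (\<lambda>i. poly (N i) t / poly 1 t) = 0"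
      using zero[of "P t"] unfolding P by simp
  qed (use deg sum_le_of_PiE_atMost in \<open>auto simp: N_def Compl_eq_Diff_UNIV card_Diff_subset\<close>)
  then show ?thesis unfolding u P .
qed

text \<open>Both 0 and the parameter of \<open>x\<close> are lost, which leaves
  \<open>CARD('a) - 2\<close> zeros; this is the strictest degree condition of the three
  conics.\<close>

lemma mpeval_vanishes_on_hyperbola:
  fixes a b c :: "'a::{field,finite} ^ 'n"
  assumes bc: "lin_indep2 b c" and x: "x \<in> hyperbola a b c"
    and deg: "2 * (CARD('n) * e) + 2 < CARD('a)"
    and zero: "\<And>y. y \<in> hyperbola a b c - {x} \<Longrightarrow> mpeval UNIV e f (($) y) = 0"
  shows "mpeval UNIV e f (($) x) = 0"
proof -
  define N where "N i = [:c $ i, a $ i, b $ i:]" for i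
  define D :: "'a poly" where "D = [:0, 1:]"
  define P where "P t = a + t *s b + inverse t *s c" for t
  have P: "($) (P t) = (\<lambda>i. poly (N i) t / poly D t)" if "t \<noteq> 0" for t
    using that by (intro ext) (simp add: P_def N_def D_def field_simps)
  obtain u where u: "x = P u" "u \<noteq> 0" using x by (auto simp: hyperbola_def P_def)
  have "mpeval UNIV e f (\<lambda>i. poly (N i) u / poly D u) = 0"
  proof (rule mpeval_vanishes_on_conic(1)[where T = "- {0, u}"])
    fix t assume t: "t \<in> - {0, u}"
    then have "P t \<noteq> P u" using lin_indep2_eqD(1)[OF bc] by (auto simp: P_def)
    then have "P t \<in> hyperbola a b c - {x}" using t by (auto simp: u hyperbola_def P_def)
    then show "poly D t \<noteq> 0 \<and> mpeval UNIV e f (\<lambda>i. poly (N i) t / poly D t) = 0"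
      using zero[of "P t"] t P[of t] by (simp add: D_def)
  qed (use u deg sum_le_of_PiE_atMost in \<open>auto simp: N_def D_def Compl_eq_Diff_UNIV card_Diff_subset\<close>)
  then show ?thesis using u P by simp
qed

section \<open>Polynomials vanishing on Nikodym and Kakeya sets\<close>

lemma mpeval_eq_0_if_conical_Nikodym:
  fixes S :: "('a::{field,finite} ^ 'n) set"
  assumes g: "\<not> (\<exists>h. g = h\<^sup>2)" and S: "conical_Nikodym g S"
    and deg: "2 * (CARD('n) * e) + 2 < CARD('a)"
    and zero: "\<And>y. y \<in> S \<Longrightarrow> mpeval UNIV e f (($) y) = 0"
  shows "mpeval UNIV e f (($) x) = 0"
proof -
  obtain C a b c where C: "x \<in> C" "C - {x} \<subseteq> S" and bc: "lin_indep2 b c"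
    and cases: "C = hyperbola a b c \<or> C = parabola a b c \<or> (\<exists>k. k \<noteq> 0 \<and> C = ellipse g k a b c)"
    using S unfolding conical_Nikodym_def is_conic_def by metis
  have "mpeval UNIV e f (($) y) = 0" if "y \<in> C - {x}" for y
    using that C zero by blast
  moreover have "2 * (CARD('n) * e) < CARD('a)" "2 * (CARD('n) * e) + 1 < CARD('a)"
    using deg by linarith+
  ultimately show ?thesis
    using cases C(1) bc g deg mpeval_vanishes_on_hyperbola mpeval_vanishes_on_parabola
      mpeval_vanishes_on_ellipse by metis
qed

text \<open>The factor \<open>0 ^ (d - sum \<alpha> UNIV)\<close> keeps exactly the terms of total
  degree \<open>d\<close>. On either curve \<open>v\<close> is the coefficient of the square of the
  parameter in the numerators, while the denominator has degree below 2, so the parameter at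
  infinity yields the form at \<open>v\<close>.\<close>

lemma leading_form_eq_0_if_conical_Kakeya:
  fixes S :: "('a::{field,finite} ^ 'n) set"
  assumes S: "conical_Kakeya S" and v: "v \<noteq> 0"
    and deg: "2 * d + 1 < CARD('a)"
    and supp: "\<And>\<alpha>. \<alpha> \<in> UNIV \<rightarrow>\<^sub>E {..e} \<Longrightarrow> f \<alpha> \<noteq> 0 \<Longrightarrow> sum \<alpha> UNIV \<le> d"
    and zero: "\<And>y. y \<in> S \<Longrightarrow> mpeval UNIV e f (($) y) = 0"
  shows "mpeval UNIV e (\<lambda>\<alpha>. f \<alpha> * 0 ^ (d - sum \<alpha> UNIV)) (($) v) = 0"
proof -
  obtain a b c where "v \<in> {b, c} \<and> hyperbola a b c \<subseteq> S \<or> v = c \<and> parabola a b c \<subseteq> S"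
    using S v unfolding conical_Kakeya_def by metis
  \<comment> \<open>Inverting the parameter swaps \<open>b\<close> and \<open>c\<close>, so
    \<open>v\<close> may be taken as the first direction of the hyperbola.\<close>
  then consider c where "hyperbola a v c \<subseteq> S" | "parabola a b v \<subseteq> S"
    using hyperbola_commute by blast
  then show ?thesis
  proof cases
    case 1
    define N where "N i = [:c $ i, a $ i, v $ i:]" for i
    define D :: "'a poly" where "D = [:0, 1:]"
    have "mpeval UNIV e (\<lambda>\<alpha>. f \<alpha> * coeff D 2 ^ (d - sum \<alpha> UNIV)) (\<lambda>i. coeff (N i) 2) = 0"
    proof (rule mpeval_vanishes_on_conic(2)[where T = "- {0}"])
      fix t :: 'a assume t: "t \<in> - {0}"
      then have "($) (a + t *s v + inverse t *s c) = (\<lambda>i. poly (N i) t / poly D t)"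
        by (intro ext) (simp add: N_def D_def field_simps)
      moreover have "a + t *s v + inverse t *s c \<in> S"
        using 1 t by (auto simp: hyperbola_def)
      ultimately show "poly D t \<noteq> 0 \<and> mpeval UNIV e f (\<lambda>i. poly (N i) t / poly D t) = 0"
        using zero[of "a + t *s v + inverse t *s c"] t by (simp add: D_def)
    qed (use deg supp in \<open>auto simp: N_def D_def Compl_eq_Diff_UNIV card_Diff_subset\<close>)
    then show ?thesis by (simp add: N_def D_def numeral_2_eq_2)
  next
    case 2
    define N where "N i = [:a $ i, b $ i, v $ i:]" for i
    have "mpeval UNIV e (\<lambda>\<alpha>. f \<alpha> * coeff 1 2 ^ (d - sum \<alpha> UNIV)) (\<lambda>i. coeff (N i) 2) = 0"
    proof (rule mpeval_vanishes_on_conic(2)[where T = UNIV])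
      fix t
      have "($) (a + t *s b + t\<^sup>2 *s v) = (\<lambda>i. poly (N i) t / poly 1 t)"
        by (intro ext) (simp add: N_def power2_eq_square algebra_simps)
      moreover have "a + t *s b + t\<^sup>2 *s v \<in> S"
        using 2 by (auto simp: parabola_def)
      ultimately show "poly 1 t \<noteq> 0 \<and> mpeval UNIV e f (\<lambda>i. poly (N i) t / poly 1 t) = 0"
        using zero by (metis poly_1 zero_neq_one)
    qed (use deg supp in \<open>auto simp: N_def\<close>)
    then show ?thesis by (simp add: N_def numeral_2_eq_2)
  qed
qed

text \<open>Otherwise let \<open>d\<close> be the total degree. The form of degree \<open>d\<close>
  vanishes at every vector, so its coefficients are zero, although one of them is a nonzero
  \<open>f \<beta>\<close> with \<open>\<beta>\<close> of sum \<open>d\<close>.\<close>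

lemma coeff_eq_0_if_conical_Kakeya:
  fixes S :: "('a::{field,finite} ^ 'n) set"
  assumes S: "conical_Kakeya S"
    and deg: "2 * (CARD('n) * e) + 1 < CARD('a)"
    and zero: "\<And>y. y \<in> S \<Longrightarrow> mpeval UNIV e f (($) y) = 0"
    and \<alpha>: "\<alpha> \<in> UNIV \<rightarrow>\<^sub>E {..e}"
  shows "f \<alpha> = 0"
proof (rule ccontr)
  assume "f \<alpha> \<noteq> 0"
  define M where "M = {\<beta> \<in> UNIV \<rightarrow>\<^sub>E {..e}. f \<beta> \<noteq> 0}"
  define d where "d = Max ((\<lambda>\<beta>. sum \<beta> UNIV) ` M)"
  define h where "h \<beta> = f \<beta> * 0 ^ (d - sum \<beta> UNIV)" for \<beta>
  have M: "finite M" "M \<noteq> {}"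
    using \<alpha> \<open>f \<alpha> \<noteq> 0\<close> finite_PiE[of UNIV "\<lambda>_ :: 'n. {..e}"] by (auto simp: M_def)
  then have "d \<in> (\<lambda>\<beta>. sum \<beta> UNIV) ` M" unfolding d_def by (intro Max_in) auto
  then obtain \<beta> where \<beta>: "\<beta> \<in> UNIV \<rightarrow>\<^sub>E {..e}" "f \<beta> \<noteq> 0" "d = sum \<beta> UNIV"
    by (auto simp: M_def)
  have le: "sum \<gamma> UNIV \<le> d" if "\<gamma> \<in> UNIV \<rightarrow>\<^sub>E {..e}" "f \<gamma> \<noteq> 0" for \<gamma>
    using M that by (auto simp: d_def M_def)
  have d: "d \<le> CARD('n) * e" using \<beta> sum_le_of_PiE_atMost by metis
  have nz: "mpeval UNIV e h (($) v) = 0" if "v \<noteq> 0" for v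
    unfolding h_def using d deg le zero
    by (intro leading_form_eq_0_if_conical_Kakeya[OF S that]) auto
  \<comment> \<open>The Kakeya property says nothing about direction 0. A constant form has the same
    value at 0 as at the all-ones vector; a form of positive degree vanishes at 0.\<close>
  have "mpeval UNIV e h (($) 0) = 0"
  proof (cases "d = 0")
    case True
    have "mpeval UNIV e h (($) 0) = mpeval UNIV e h (($) 1)"
      unfolding mpeval_def
    proof (rule sum.cong[OF refl])
      fix \<gamma> assume "\<gamma> \<in> (UNIV :: 'n set) \<rightarrow>\<^sub>E {..e}"
      then have "f \<gamma> = 0 \<or> (\<forall>i. \<gamma> i = 0)" using le[of \<gamma>] True by auto
      then show "h \<gamma> * (\<Prod>i\<in>UNIV. 0 $ i ^ \<gamma> i) = h \<gamma> * (\<Prod>i\<in>UNIV. 1 $ i ^ \<gamma> i)"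
        by (auto simp: h_def)
    qed
    then show ?thesis using nz[of 1] by (simp add: vec_eq_iff)
  next
    case False
    show ?thesis
      unfolding mpeval_def
    proof (intro sum.neutral ballI)
      fix \<gamma>
      show "h \<gamma> * (\<Prod>i\<in>UNIV. 0 $ i ^ \<gamma> i) = 0"
      proof (cases "\<exists>i. \<gamma> i \<noteq> 0")
        case True
        then show ?thesis by auto
      next
        case False
        then show ?thesis using \<open>d \<noteq> 0\<close> by (simp add: h_def)
      qed
    qed
  qed
  with nz have "mpeval UNIV e h (($) v) = 0" for v by (cases "v = 0") auto
  then have "h \<beta> = 0"
    using \<beta>(1) deg by (intro coeff_eq_0_if_mpeval_vec_eq_0[of e h]) auto
  then show False using \<beta> by (simp add: h_def)
qed

section \<open>The lower bound for the size\<close>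

theorem theorem1:
  fixes g :: "'a::{field,finite}"
    and S :: "('a ^ 'n) set"
    and p m q n :: nat
  assumes "prime p" and "odd p" and "m \<ge> 1" and "q = p ^ m"
    and "CARD('a) = q"
    and "CARD('n) = n" and "n \<ge> 2"
    and "g \<noteq> 0" and "\<not> (\<exists>h. g = h\<^sup>2)"
    and "conical_Kakeya S \<or> conical_Nikodym g S"
  shows "real (card S) \<ge> ((real q - 1) / (2 * real n)) ^ n"
proof (rule ccontr)
  assume small: "\<not> ?thesis"
  \<comment> \<open>The largest \<open>e\<close> with \<open>2 * n * e + 3 \<le> q\<close>, as the
    hyperbola requires.\<close>
  define e where "e = ((q - 3) div 2) div n"
  \<comment> \<open>As \<open>q\<close> is odd and above 1, neither the subtraction of 3 nor the
    halving in \<open>e\<close> loses anything.\<close>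
  have "odd q" using assms(2,4) by simp
  moreover have "1 < q" using card_mono[of UNIV "{0, 1 :: 'a}"] assms(5) by simp
  ultimately have q: "2 * ((q - 3) div 2) + 3 = q" by presburger
  have "n * e \<le> (q - 3) div 2" by (simp add: e_def)
  then have deg: "2 * (CARD('n) * e) + 2 < CARD('a)"
    using q unfolding assms(5,6) by linarith
  \<comment> \<open>Maximality of \<open>e\<close>: the strict inequality, rounded up to integers,
    gains the 1 that turns \<open>q - 3\<close> into \<open>q - 1\<close>.\<close>
  have "(q - 3) div 2 + 1 \<le> n * (e + 1)"
    using assms(7) dividend_less_times_div[of n "(q - 3) div 2"] by (simp add: e_def)
  then have "q - 1 \<le> 2 * (n * (e + 1))" using q by linarith
  then have "real (q - 1) \<le> real (2 * (n * (e + 1)))" by (rule of_nat_mono)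
  then have "(real q - 1) / (2 * real n) \<le> real (e + 1)"
    using \<open>1 < q\<close> assms(7) by (simp add: field_simps of_nat_diff)
  then have "((real q - 1) / (2 * real n)) ^ n \<le> real ((e + 1) ^ n)"
    using \<open>1 < q\<close> unfolding of_nat_power by (intro power_mono) auto
  with small have "real (card S) < real ((e + 1) ^ n)" by linarith
  then have "card S < (e + 1) ^ n" by linarith
  \<comment> \<open>\<open>mpeval\<close> takes functions, so \<open>S\<close> is replaced by its
    set of coordinate functions, of the same size.\<close>
  moreover have "card ((\<lambda>y. ($) y) ` S) = card S"
    by (intro card_image inj_onI) (simp add: vec_eq_iff fun_eq_iff)
  ultimately obtain f \<alpha> where f: "\<And>y. y \<in> S \<Longrightarrow> mpeval UNIV e f (($) y) = 0"
    and \<alpha>: "\<alpha> \<in> (UNIV :: 'n set) \<rightarrow>\<^sub>E {..e}" "f \<alpha> \<noteq> 0"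
    using exists_vanishing_mpeval[of UNIV "(\<lambda>y. ($) y) ` S" e] assms(6) by (metis finite finite_imageI imageI)
  from assms(10) show False
  proof
    assume "conical_Kakeya S"
    then show False using coeff_eq_0_if_conical_Kakeya[of S e f \<alpha>] f \<alpha> deg by simp
  next
    assume "conical_Nikodym g S"
    then have "mpeval UNIV e f (($) y) = 0" for y
      using mpeval_eq_0_if_conical_Nikodym assms(9) deg f by blast
    then show False
      using \<alpha> deg coeff_eq_0_if_mpeval_vec_eq_0[of e f \<alpha>] by simp
  qed
qed

end
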